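(* Fix an integration structure $((\Omega,\mathcal H),\mathfrak N,((X,\eta_1),(Y,\eta_2),(Z,\eta_3);\bullet))$ with $\Omega\in\mathcal H$. Let $f:\Omega\to X$ be an $\mathcal H$-simple function, i.e. $f=\sum_{i=1}^n x_i\mathbf 1_{A_i}$ with $x_1,\dots,x_n\in X$ and $A_1,\dots,A_n\in\mathcal H$ (not necessarily disjoint). If $\mu:\mathcal H\to Y$ is a regular integrator, then $f$ is net Riemann integrable (on $\Omega$) with respect to $\mu$ and $$\int_\Omega f\,d\mu=\sum_{i=1}^n x_i\,\mu(A_i).$$
   Context: A net convergence structure $\eta$ on a set $V$ assigns to each $v\in V$ a class $\eta(v)$ of nets in $V$ (those "converging to $v$") such that: (i) constant nets equal to $v$ converge to $v$; (ii) every quasi-subnet of a net converging to $v$ converges to $v$, where $(y_j)_{j\in J}$ is a quasi-subnet of $(x_i)_{i\in I}$ if for every $i_0\in I$ there is $j_0\in J$ with $\{y_j:j\ge j_0\}\subseteq\{x_i:i\ge i_0\}$; (iii) if $(x_i)_{i\in I}$ and $(y_i)_{i\in I}$ converge to $v$ and $z_i\in\{x_i,y_i\}$ for all $i$, then $(z_i)$ converges to $v$. A map is continuous if it sends nets converging to $v$ to nets converging to the image of $v$; products carry coordinatewise convergence. Standing assumptions: vector spaces are real; all net convergence structures are Hausdorff (limits are unique); on a vector space, addition and multiplication by each fixed real number are continuous. A bilinear product is a bilinear map $\bullet:X\times Y\to Z$ (written by juxtaposition) such that $x\mapsto x\bullet y$ and $y\mapsto x\bullet y$ are continuous. A paved space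 $(\Omega,\mathcal H)$ is a nonempty set $\Omega$ with a collection $\mathcal H$ of subsets with $\emptyset\in\mathcal H$. For each $A\in\mathcal H$ a Fleischer–Szabó–Száz net $\{(\sigma_\gamma,\tau_\gamma)\}_{\gamma\in\Gamma_A}$ is given: $\Gamma_A$ is a directed set and $\sigma_\gamma=\{\sigma_{\gamma_i}\}_{i\in I_\gamma}$, $\tau_\gamma=\{\tau_{\gamma_i}\}_{i\in I_\gamma}$ are finite families in $\mathcal H$ and $\Omega$ respectively. An integration structure consists of $(\Omega,\mathcal H)$, these nets $\mathfrak N$, and vector spaces with net convergence structures connected by a bilinear product. For $f:\Omega\to X$, $\mu:\mathcal H\to Y$ put $S^A_\gamma(f,\mu)=\sum_{i\in I_\gamma}f(\tau_{\gamma_i})\mu(\sigma_{\gamma_i})$. $f$ is net Riemann integrable on $A$ if $\int_A f\,d\mu:=\lim_{\gamma\in\Gamma_A}S^A_\gamma(f,\mu)$ exists in $(Z,\eta_3)$. $\mu:\mathcal H\to Y$ is a regular integrator if $\int_A\mathbf 1_\Omega\,d\mu=\mu(A)$ and $\int_\Omega\mathbf 1_A\,d\mu=\mu(A)$ for each $A\in\mathcal H$; here indicator functions are real valued and are integrated with the same nets using scalar multiplication $\mathbb R\times Y\to Y$, the limit being taken in $(Y,\eta_2)$. *)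

theory Defs
  imports "HOL-Analysis.Analysis"
begin

text \<open>
  A directed set is given by its order relation \<open>r\<close>, the carrier being \<open>Field r\<close>
  (no information is lost, as \<open>r\<close> is reflexive on the carrier).  Directed sets are nonempty and
  need not be antisymmetric.  A net is a pair of a directed set and a function, whose
  values outside \<open>Field r\<close> are irrelevant.

  HOL has no proper classes, so \<open>\<eta> v\<close> collects the nets whose directed sets live on one
  type \<open>'i\<close>, the same type that carries the directed sets \<open>\<Gamma>\<^sub>A\<close> of an integration
  structure.  As \<open>'i\<close> is a type variable, results are about directed sets of any size.
\<close>

definition directed :: "'i rel \<Rightarrow> bool" where
  "directed r \<longleftrightarrow> r \<noteq> {} \<and> Preorder r \<and>
     (\<forall>i\<in>Field r. \<forall>j\<in>Field r. \<exists>k. (i, k) \<in> r \<and> (j, k) \<in> r)"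

type_synonym ('i, 'v) net = "'i rel \<times> ('i \<Rightarrow> 'v)"

type_synonym ('i, 'v) convergence = "'v \<Rightarrow> ('i, 'v) net set"

text \<open>\<open>r `` {i}\<close> is the tail \<open>{i'. i' \<ge> i}\<close>.\<close>

definition quasi_subnet :: "('j, 'v) net \<Rightarrow> ('i, 'v) net \<Rightarrow> bool" where
  "quasi_subnet = (\<lambda>(s, y) (r, x).
     \<forall>i\<in>Field r. \<exists>j\<in>Field s. y ` (s `` {j}) \<subseteq> x ` (r `` {i}))"

locale net_convergence =
  fixes \<eta> :: "('i, 'v) convergence"
  assumes directed_net: "(r, x) \<in> \<eta> v \<Longrightarrow> directed r"
    and constant_net: "directed r \<Longrightarrow> (\<And>i. i \<in> Field r \<Longrightarrow> x i = v) \<Longrightarrow> (r, x) \<in> \<eta> v"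
    and quasi_subnet_closed:
      "(r, x) \<in> \<eta> v \<Longrightarrow> directed s \<Longrightarrow> quasi_subnet (s, y) (r, x) \<Longrightarrow> (s, y) \<in> \<eta> v"
    and mixing:
      "(r, x) \<in> \<eta> v \<Longrightarrow> (r, y) \<in> \<eta> v \<Longrightarrow> (\<And>i. i \<in> Field r \<Longrightarrow> z i \<in> {x i, y i}) \<Longrightarrow> (r, z) \<in> \<eta> v"

definition net_continuous ::
  "('i, 'v) convergence \<Rightarrow> ('i, 'w) convergence \<Rightarrow> ('v \<Rightarrow> 'w) \<Rightarrow> bool" where
  "net_continuous \<eta> \<eta>' h \<longleftrightarrow> (\<forall>v r x. (r, x) \<in> \<eta> v \<longrightarrow> (r, h \<circ> x) \<in> \<eta>' (h v))"

definition prod_convergence ::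
  "('i, 'v) convergence \<Rightarrow> ('i, 'w) convergence \<Rightarrow> ('i, 'v \<times> 'w) convergence" where
  "prod_convergence \<eta> \<eta>' = (\<lambda>(v, w). {(r, z). (r, fst \<circ> z) \<in> \<eta> v \<and> (r, snd \<circ> z) \<in> \<eta>' w})"

locale net_convergence_vector_space = net_convergence \<eta>
  for \<eta> :: "('i, 'v::real_vector) convergence" +
  assumes hausdorff: "(r, x) \<in> \<eta> v \<Longrightarrow> (r, x) \<in> \<eta> w \<Longrightarrow> v = w"
    and continuous_add: "net_continuous (prod_convergence \<eta> \<eta>) \<eta> (\<lambda>(a, b). a + b)"
    and continuous_scaleR: "net_continuous \<eta> \<eta> (\<lambda>a. c *\<^sub>R a)"

text \<open>
  A Fleischer-Szabo-Szasz net: a directed set and, for each of its elements \<open>\<gamma>\<close>, a finite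
  index set \<open>idx N \<gamma>\<close> with the two families \<open>\<sigma>\<^sub>\<gamma>\<close> and \<open>\<tau>\<^sub>\<gamma>\<close> indexed by it.
\<close>

record ('i, 'k, 'w) fss_net =
  dir :: "'i rel"
  idx :: "'i \<Rightarrow> 'k set"
  cell :: "'i \<Rightarrow> 'k \<Rightarrow> 'w set"
  tag :: "'i \<Rightarrow> 'k \<Rightarrow> 'w"

locale paved_space =
  fixes \<Omega> :: "'w set" and H :: "'w set set"
  assumes space_nonempty: "\<Omega> \<noteq> {}"
    and paving_subset: "H \<subseteq> Pow \<Omega>"
    and empty_in_paving: "{} \<in> H"

locale integration_structure =
  paved_space \<Omega> H +
  X: net_convergence_vector_space \<eta>\<^sub>1 +
  Y: net_convergence_vector_space \<eta>\<^sub>2 +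
  Z: net_convergence_vector_space \<eta>\<^sub>3
  for \<Omega> :: "'w set" and H :: "'w set set"
    and N :: "'w set \<Rightarrow> ('i, 'k, 'w) fss_net"
    and \<eta>\<^sub>1 :: "('i, 'x::real_vector) convergence"
    and \<eta>\<^sub>2 :: "('i, 'y::real_vector) convergence"
    and \<eta>\<^sub>3 :: "('i, 'z::real_vector) convergence"
    and bprod :: "'x \<Rightarrow> 'y \<Rightarrow> 'z" +
  assumes fss_directed: "A \<in> H \<Longrightarrow> directed (dir (N A))"
    and fss_finite: "A \<in> H \<Longrightarrow> \<gamma> \<in> Field (dir (N A)) \<Longrightarrow> finite (idx (N A) \<gamma>)"
    and fss_cell: "A \<in> H \<Longrightarrow> \<gamma> \<in> Field (dir (N A)) \<Longrightarrow> k \<in> idx (N A) \<gamma> \<Longrightarrow> cell (N A) \<gamma> k \<in> H"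
    and fss_tag: "A \<in> H \<Longrightarrow> \<gamma> \<in> Field (dir (N A)) \<Longrightarrow> k \<in> idx (N A) \<gamma> \<Longrightarrow> tag (N A) \<gamma> k \<in> \<Omega>"
    and bilinear_bprod: "bilinear bprod"
    and continuous_bprod_left: "net_continuous \<eta>\<^sub>1 \<eta>\<^sub>3 (\<lambda>x. bprod x y)"
    and continuous_bprod_right: "net_continuous \<eta>\<^sub>2 \<eta>\<^sub>3 (\<lambda>y. bprod x y)"

definition riemann_sum ::
  "('a \<Rightarrow> 'b \<Rightarrow> 'c::real_vector) \<Rightarrow> ('i, 'k, 'w) fss_net \<Rightarrow> ('w \<Rightarrow> 'a) \<Rightarrow> ('w set \<Rightarrow> 'b) \<Rightarrow> 'i \<Rightarrow> 'c" where
  "riemann_sum p F f \<mu> \<gamma> = (\<Sum>k\<in>idx F \<gamma>. p (f (tag F \<gamma> k)) (\<mu> (cell F \<gamma> k)))"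

text \<open>
  The product \<open>p\<close> and the convergence \<open>\<eta>\<close> on its target are parameters, because regularity of
  an integrator uses scalar multiplication and \<open>\<eta>\<^sub>2\<close> instead of the given bilinear product
  and \<open>\<eta>\<^sub>3\<close>.
\<close>

definition net_integrable ::
  "('a \<Rightarrow> 'b \<Rightarrow> 'c::real_vector) \<Rightarrow> ('i, 'c) convergence \<Rightarrow> ('w set \<Rightarrow> ('i, 'k, 'w) fss_net) \<Rightarrow>
    'w set \<Rightarrow> ('w \<Rightarrow> 'a) \<Rightarrow> ('w set \<Rightarrow> 'b) \<Rightarrow> bool" where
  "net_integrable p \<eta> N A f \<mu> \<longleftrightarrow> (\<exists>z. (dir (N A), riemann_sum p (N A) f \<mu>) \<in> \<eta> z)"

definition net_integral ::
  "('a \<Rightarrow> 'b \<Rightarrow> 'c::real_vector) \<Rightarrow> ('i, 'c) convergence \<Rightarrow> ('w set \<Rightarrow> ('i, 'k, 'w) fss_net) \<Rightarrow>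
    'w set \<Rightarrow> ('w \<Rightarrow> 'a) \<Rightarrow> ('w set \<Rightarrow> 'b) \<Rightarrow> 'c" where
  "net_integral p \<eta> N A f \<mu> = (THE z. (dir (N A), riemann_sum p (N A) f \<mu>) \<in> \<eta> z)"

definition regular_integrator ::
  "'w set \<Rightarrow> 'w set set \<Rightarrow> ('w set \<Rightarrow> ('i, 'k, 'w) fss_net) \<Rightarrow> ('i, 'y::real_vector) convergence \<Rightarrow>
    ('w set \<Rightarrow> 'y) \<Rightarrow> bool" where
  "regular_integrator \<Omega> H N \<eta> \<mu> \<longleftrightarrow> (\<forall>A\<in>H.
     net_integrable scaleR \<eta> N A (indicat_real \<Omega>) \<mu> \<and>
     net_integral scaleR \<eta> N A (indicat_real \<Omega>) \<mu> = \<mu> A \<and>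
     net_integrable scaleR \<eta> N \<Omega> (indicat_real A) \<mu> \<and>
     net_integral scaleR \<eta> N \<Omega> (indicat_real A) \<mu> = \<mu> A)"

end

theory Submission
  imports Defs
begin

text \<open>
  Because the product is bilinear, each Riemann sum of a simple function is exactly a linear
  combination of Riemann sums of indicator functions: grouping by the coefficients instead of by
  the cells gives
  \<open>S\<^sub>\<gamma>(\<Sum>\<^sub>i x\<^sub>i 1\<^bsub>A\<^sub>i\<^esub>, \<mu>) = \<Sum>\<^sub>i x\<^sub>i \<bullet> S\<^sub>\<gamma>(1\<^bsub>A\<^sub>i\<^esub>, \<mu>)\<close>
  (lemma \<open>riemann_sum_simple\<close>).  Regularity of \<open>\<mu>\<close> says that \<open>S\<^sub>\<gamma>(1\<^bsub>A\<^sub>i\<^esub>, \<mu>)\<close> converges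
  to \<open>\<mu>(A\<^sub>i)\<close> along the net of \<open>\<Omega>\<close>; continuity of \<open>y \<mapsto> x\<^sub>i \<bullet> y\<close> and of finite
  sums (lemma \<open>converges_sum\<close>) then carries the limit through the right-hand side.
\<close>

text \<open>
  Values of a net outside its directed set are junk.  Mixing a net with itself leaves no choice on
  the directed set and full freedom off it.
\<close>

lemma (in net_convergence) converges_cong:
  assumes "(r, x) \<in> \<eta> v" and "\<And>i. i \<in> Field r \<Longrightarrow> y i = x i"
  shows "(r, y) \<in> \<eta> v"
  using assms by (intro mixing[OF assms(1) assms(1)]) simp

lemma (in net_convergence_vector_space) converges_add:
  assumes "(r, x) \<in> \<eta> v" and "(r, y) \<in> \<eta> w"
  shows "(r, \<lambda>i. x i + y i) \<in> \<eta> (v + w)"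
proof -
  have "(r, \<lambda>i. (x i, y i)) \<in> prod_convergence \<eta> \<eta> (v, w)"
    using assms by (simp add: prod_convergence_def comp_def)
  then show ?thesis
    using continuous_add unfolding net_continuous_def by (fastforce simp: comp_def)
qed

text \<open>
  Directedness of \<open>r\<close> is an explicit hypothesis because an empty sum leaves no convergent net to
  supply it; the zero net then converges as a constant net.
\<close>

lemma (in net_convergence_vector_space) converges_sum:
  assumes "directed r" and "\<And>k. k \<in> K \<Longrightarrow> (r, x k) \<in> \<eta> (v k)"
  shows "(r, \<lambda>i. \<Sum>k\<in>K. x k i) \<in> \<eta> (\<Sum>k\<in>K. v k)"
  using assms(2)
proof (induction K rule: infinite_finite_induct)
  case (insert k K)
  then show ?case by (simp add: converges_add)
qed (simp_all add: constant_net assms(1))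

text \<open>Uniqueness of limits is what makes the definite description in the integral meaningful.\<close>

lemma (in net_convergence_vector_space) net_integral_iff_converges:
  "net_integrable p \<eta> N A f \<mu> \<and> net_integral p \<eta> N A f \<mu> = z \<longleftrightarrow>
     (dir (N A), riemann_sum p (N A) f \<mu>) \<in> \<eta> z"
proof -
  have "net_integral p \<eta> N A f \<mu> = w" if "(dir (N A), riemann_sum p (N A) f \<mu>) \<in> \<eta> w" for w
    unfolding net_integral_def using that by (blast intro: the_equality hausdorff)
  then show ?thesis
    unfolding net_integrable_def by blast
qed

lemma riemann_sum_simple:
  assumes "bilinear p"
    and f: "\<And>k. k \<in> idx F \<gamma> \<Longrightarrow>
      f (tag F \<gamma> k) = (\<Sum>i\<in>I. indicat_real (A i) (tag F \<gamma> k) *\<^sub>R x i)"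
  shows "riemann_sum p F f \<mu> \<gamma> = (\<Sum>i\<in>I. p (x i) (riemann_sum scaleR F (indicat_real (A i)) \<mu> \<gamma>))"
proof -
  have left: "linear (\<lambda>a. p a b)" and right: "linear (p a)" for a b
    using assms(1) by (simp_all add: bilinear_def)
  let ?c = "\<lambda>i k. indicat_real (A i) (tag F \<gamma> k)"
  let ?m = "\<lambda>k. \<mu> (cell F \<gamma> k)"
  have "riemann_sum p F f \<mu> \<gamma> = (\<Sum>k\<in>idx F \<gamma>. p (\<Sum>i\<in>I. ?c i k *\<^sub>R x i) (?m k))"
    unfolding riemann_sum_def using f by simp
  \<comment> \<open>The real coefficient passes from the left argument to the right one: there it forms the
    Riemann sum of an indicator, which takes its values in the space of the integrator.\<close>
  also have "\<dots> = (\<Sum>k\<in>idx F \<gamma>. \<Sum>i\<in>I. p (x i) (?c i k *\<^sub>R ?m k))"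
    by (simp add: linear_sum[OF left] linear_scale[OF left] linear_scale[OF right])
  also have "\<dots> = (\<Sum>i\<in>I. \<Sum>k\<in>idx F \<gamma>. p (x i) (?c i k *\<^sub>R ?m k))"
    by (rule sum.swap)
  also have "\<dots> = (\<Sum>i\<in>I. p (x i) (riemann_sum scaleR F (indicat_real (A i)) \<mu> \<gamma>))"
    by (simp add: riemann_sum_def linear_sum[OF right])
  finally show ?thesis .
qed

theorem proposition2p1:
  fixes \<Omega> :: "'w set" and H :: "'w set set"
    and N :: "'w set \<Rightarrow> ('i, 'k, 'w) fss_net"
    and \<eta>\<^sub>1 :: "('i, 'x::real_vector) convergence"
    and \<eta>\<^sub>2 :: "('i, 'y::real_vector) convergence"
    and \<eta>\<^sub>3 :: "('i, 'z::real_vector) convergence"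
    and bprod :: "'x \<Rightarrow> 'y \<Rightarrow> 'z"
    and f :: "'w \<Rightarrow> 'x" and n :: nat and x :: "nat \<Rightarrow> 'x" and A :: "nat \<Rightarrow> 'w set"
    and \<mu> :: "'w set \<Rightarrow> 'y"
  assumes "integration_structure \<Omega> H N \<eta>\<^sub>1 \<eta>\<^sub>2 \<eta>\<^sub>3 bprod"
    and "\<Omega> \<in> H"
    and "\<And>i. i \<in> {1..n} \<Longrightarrow> A i \<in> H"
    and "\<And>\<omega>. \<omega> \<in> \<Omega> \<Longrightarrow> f \<omega> = (\<Sum>i=1..n. indicat_real (A i) \<omega> *\<^sub>R x i)"
    and "regular_integrator \<Omega> H N \<eta>\<^sub>2 \<mu>"
  shows "net_integrable bprod \<eta>\<^sub>3 N \<Omega> f \<mu> \<and>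
         net_integral bprod \<eta>\<^sub>3 N \<Omega> f \<mu> = (\<Sum>i=1..n. bprod (x i) (\<mu> (A i)))"
proof -
  interpret integration_structure \<Omega> H N \<eta>\<^sub>1 \<eta>\<^sub>2 \<eta>\<^sub>3 bprod by (fact assms(1))
  let ?r = "dir (N \<Omega>)"
  let ?S = "\<lambda>i. riemann_sum scaleR (N \<Omega>) (indicat_real (A i)) \<mu>"
  have "(?r, ?S i) \<in> \<eta>\<^sub>2 (\<mu> (A i))" if "i \<in> {1..n}" for i
    using assms(3)[OF that] assms(5) Y.net_integral_iff_converges
    unfolding regular_integrator_def by blast
  then have "(?r, \<lambda>\<gamma>. bprod (x i) (?S i \<gamma>)) \<in> \<eta>\<^sub>3 (bprod (x i) (\<mu> (A i)))" if "i \<in> {1..n}" for i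
    using that continuous_bprod_right unfolding net_continuous_def comp_def by blast
  then have "(?r, \<lambda>\<gamma>. \<Sum>i=1..n. bprod (x i) (?S i \<gamma>)) \<in> \<eta>\<^sub>3 (\<Sum>i=1..n. bprod (x i) (\<mu> (A i)))"
    using fss_directed[OF assms(2)] by (intro Z.converges_sum)
  then have "(?r, riemann_sum bprod (N \<Omega>) f \<mu>) \<in> \<eta>\<^sub>3 (\<Sum>i=1..n. bprod (x i) (\<mu> (A i)))"
  proof (rule Z.converges_cong)
    fix \<gamma> assume "\<gamma> \<in> Field ?r"
    \<comment> \<open>The representation of \<open>f\<close> holds on \<open>\<Omega>\<close> only, and that is where the tags lie.\<close>
    then show "riemann_sum bprod (N \<Omega>) f \<mu> \<gamma> = (\<Sum>i=1..n. bprod (x i) (?S i \<gamma>))"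
      using assms(2,4) fss_tag by (intro riemann_sum_simple bilinear_bprod) blast
  qed
  then show ?thesis
    by (simp only: Z.net_integral_iff_converges)
qed

end
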